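(* Let $R>0$, $Cu>0$, $b>0$, $\alpha>0$, $c\in(0,1)$, $n\in\mathbb{R}$, and suppose that one of the following conditions holds: (i) $n\ge 0$; (ii) $n<0$ and $\displaystyle\left(1-\frac{\alpha+1}{n}\right)^{\frac{n-1-\alpha}{\alpha}}<\frac{1-c}{\alpha c}$. Then the boundary value problem $$\frac{1}{Y}\frac{d}{dY}\left\{\left[1-c+c\left(1+Cu^\alpha |U_Y|^\alpha\right)^{\frac{n-1}{\alpha}}\right]Y\,U_Y\right\}=b \quad\text{for } Y\in(0,R),\qquad U_Y(0)=U(R)=0,$$ has a unique classical solution $U\in C^2([0,R])$, and it satisfies $$U(Y)=-\int_Y^R F^{-1}\left(\frac{bs}{2}\right)ds\quad\text{and}\quad 0\le U_Y(Y)\le F^{-1}\left(\frac{bR}{2}\right)\quad\text{for } Y\in[0,R].$$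
   Context: $U=U(Y)$ is a real-valued function on $[0,R]$ and $U_Y=dU/dY$. $Cu$ is a single symbol (a real number, the Carreau number) and $Cu^\alpha$ denotes its $\alpha$-th power. A classical solution is a function $U\in C^2((0,R))\cap C^1([0,R])$ satisfying the equation pointwise in $(0,R)$ and the boundary conditions $U_Y(0)=U(R)=0$. The function $F:[0,\infty)\to\mathbb{R}$ is $$F(\zeta)=\left[1-c+c\left(1+Cu^\alpha\zeta^\alpha\right)^{\frac{n-1}{\alpha}}\right]\zeta,\qquad \zeta\ge0,$$ and $F^{-1}:[0,\infty)\to[0,\infty)$ denotes its inverse function. *)

theory Defs
  imports "HOL-Analysis.Analysis"
begin

text \<open>
  Functions on an interval \<open>S\<close> are represented by total functions on the reals. Derivatives are
  taken relative to \<open>S\<close>, hence one-sided at the end points, so that only values on \<open>S\<close> matter.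
  The definitions are meant for sets \<open>S\<close> without isolated points, where derivatives are unique.
\<close>

abbreviation deriv_on :: "real set \<Rightarrow> (real \<Rightarrow> real) \<Rightarrow> real \<Rightarrow> real" where
  "deriv_on S f x \<equiv> vector_derivative f (at x within S)"

primrec C_k_on :: "nat \<Rightarrow> (real \<Rightarrow> real) \<Rightarrow> real set \<Rightarrow> bool" where
  "C_k_on 0 f S \<longleftrightarrow> continuous_on S f"
| "C_k_on (Suc k) f S \<longleftrightarrow> f differentiable_on S \<and> C_k_on k (deriv_on S f) S"

definition carreau_factor :: "real \<Rightarrow> real \<Rightarrow> real \<Rightarrow> real \<Rightarrow> real \<Rightarrow> real" where
  "carreau_factor Cu \<alpha> c n \<zeta> =
     1 - c + c * (1 + Cu powr \<alpha> * \<zeta> powr \<alpha>) powr ((n - 1) / \<alpha>)"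

text \<open>Only the restriction of \<open>carreau_F\<close> to \<open>[0, \<infinity>)\<close> is meaningful.\<close>

definition carreau_F :: "real \<Rightarrow> real \<Rightarrow> real \<Rightarrow> real \<Rightarrow> real \<Rightarrow> real" where
  "carreau_F Cu \<alpha> c n \<zeta> = carreau_factor Cu \<alpha> c n \<zeta> * \<zeta>"

definition carreau_F_inv :: "real \<Rightarrow> real \<Rightarrow> real \<Rightarrow> real \<Rightarrow> real \<Rightarrow> real" where
  "carreau_F_inv Cu \<alpha> c n = inv_into {0..} (carreau_F Cu \<alpha> c n)"

definition carreau_flux ::
    "real \<Rightarrow> real \<Rightarrow> real \<Rightarrow> real \<Rightarrow> real \<Rightarrow> (real \<Rightarrow> real) \<Rightarrow> real \<Rightarrow> real" where
  "carreau_flux R Cu \<alpha> c n U Y =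
     carreau_factor Cu \<alpha> c n \<bar>deriv_on {0..R} U Y\<bar> * Y * deriv_on {0..R} U Y"

definition classical_solution ::
    "real \<Rightarrow> real \<Rightarrow> real \<Rightarrow> real \<Rightarrow> real \<Rightarrow> real \<Rightarrow> (real \<Rightarrow> real) \<Rightarrow> bool" where
  "classical_solution R Cu b \<alpha> c n U \<longleftrightarrow>
     C_k_on 2 U {0<..<R} \<and> C_k_on 1 U {0..R} \<and>
     (\<forall>Y\<in>{0<..<R}. carreau_flux R Cu \<alpha> c n U field_differentiable at Y \<and>
                    1 / Y * deriv (carreau_flux R Cu \<alpha> c n U) Y = b) \<and>
     deriv_on {0..R} U 0 = 0 \<and> U R = 0"

end

theory Submission
  imports Defs
begin

text \<open>
  Extend \<open>carreau_F\<close> to an odd function \<open>T p = carreau_factor \<bar>p\<bar> * p\<close> on the whole line. The equation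
  then reads \<open>(Y * T (U' Y))' = b * Y\<close>. Since \<open>Y * T (U' Y)\<close> is continuous on \<open>[0, R]\<close> and
  vanishes at \<open>0\<close>, integrating gives \<open>Y * T (U' Y) = b * Y\<^sup>2 / 2\<close>
  (\<open>classical_solution_first_integral\<close>), so the problem is equivalent to the algebraic equation
  \<open>T (U' Y) = b * Y / 2\<close>. If \<open>T\<close> is a bijection, this determines \<open>U'\<close>, and the
  condition \<open>U R = 0\<close> determines \<open>U\<close>. If the inverse of \<open>T\<close> is also \<open>C\<^sup>1\<close>, the function so obtained
  is \<open>C\<^sup>2\<close> up to both end points. As \<open>T\<close> preserves signs and agrees with
  \<open>carreau_F\<close> on \<open>[0, \<infinity>)\<close>, its inverse agrees there with \<open>carreau_F_inv\<close>; the bounds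
  on \<open>U'\<close> are the monotonicity of this inverse.

  What remains is that \<open>T\<close> is a \<open>C\<^sup>1\<close> diffeomorphism of the line, which follows once \<open>T'\<close> is
  continuous and bounded below by a positive constant (\<open>C1_diffeo_of_slope_bounded_below\<close>). With
  \<open>w = 1 + Cu\<^sup>\<alpha> \<bar>p\<bar>\<^sup>\<alpha>\<close> and \<open>r = (n - 1 - \<alpha>) / \<alpha>\<close> one has
  \<open>T' p = 1 - c + c * w\<^sup>r * (1 + n * (w - 1))\<close>. For \<open>n \<ge> 0\<close> this is at least \<open>1 - c\<close>. For \<open>n < 0\<close>
  the function \<open>w\<^sup>r * (1 + n * (w - 1))\<close> has its minimum at \<open>w = 1 - (\<alpha> + 1) / n\<close>, where
  \<open>1 + n * (w - 1) = - \<alpha>\<close>, and condition (ii) says precisely that \<open>T'\<close> is positive at this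
  minimum (\<open>carreau_critical_bound\<close>, \<open>carreau_slope_bounded_below\<close>).
\<close>

section \<open>A lower bound for the slope of the stress\<close>

text \<open>Concavity of the logarithm, applied to \<open>x\<close> as the convex combination of \<open>1\<close> and
  \<open>1 + q * (x - 1)\<close> with weight \<open>1 / q\<close>.\<close>

lemma Bernoulli_powr:
  fixes q x :: real
  assumes "1 \<le> q" "0 < x"
  shows "1 + q * (x - 1) \<le> x powr q"
proof (cases "0 < 1 + q * (x - 1)")
  case True
  define t where "t = 1 + q * (x - 1)"
  have t: "0 < t" "x = 1 * (1 - 1 / q) + t * (1 / q)"
    using True assms by (auto simp: t_def field_simps)
  have "concave_on {0<..} (ln :: real \<Rightarrow> real)" by (rule ln_concave)
  from concave_onD[OF this, of "1/q" 1 t]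
  have "(1 - 1 / q) * ln 1 + 1 / q * ln t \<le> ln (1 * (1 - 1 / q) + t * (1 / q))"
    using t(1) assms by (simp add: mult.commute)
  then have "ln t / q \<le> ln x" unfolding t(2)[symmetric] by simp
  then have "ln t \<le> q * ln x" using assms by (simp add: field_simps)
  then have "exp (ln t) \<le> exp (q * ln x)" by simp
  then have "t \<le> exp (q * ln x)" unfolding exp_ln[OF t(1)] .
  then show ?thesis using assms(2) by (simp add: powr_def t_def)
next
  case False
  then show ?thesis by (smt (verit) powr_ge_zero)
qed

text \<open>The left-hand side is the value of the right-hand side at its critical point
  \<open>w0 = 1 - (\<alpha> + 1) / n\<close>. Division by \<open>w powr p\<close> turns the claim into the inequality between the
  convex function \<open>\<alpha> * (w / w0) powr (- p)\<close> and its tangent line at \<open>w0\<close>, which is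
  \<open>- (1 + n * (w - 1))\<close>; this is Bernoulli's inequality with exponent \<open>- p \<ge> 1\<close>.\<close>

lemma carreau_critical_bound:
  fixes \<alpha> n w :: real
  assumes "0 < \<alpha>" "n < 0" "0 < w"
  defines "p \<equiv> (n - 1 - \<alpha>) / \<alpha>"
  shows "- \<alpha> * (1 - (\<alpha> + 1) / n) powr p \<le> w powr p * (1 + n * (w - 1))"
proof -
  define w0 where "w0 = 1 - (\<alpha> + 1) / n"
  have w0: "0 < w0" "n * w0 = \<alpha> * p"
    using assms by (auto simp: w0_def p_def field_simps add_pos_pos mult_pos_neg)
  have "1 \<le> - p" using assms by (simp add: p_def field_simps)
  from Bernoulli_powr[OF this, of "w / w0"]
  have "1 - p * (w / w0 - 1) \<le> (w / w0) powr (- p)" using assms w0 by simp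
  also have "\<dots> = w0 powr p / w powr p"
    using assms w0 by (simp add: powr_divide powr_minus field_simps)
  finally have "\<alpha> * (1 - p * (w / w0 - 1)) \<le> \<alpha> * (w0 powr p / w powr p)"
    using \<open>0 < \<alpha>\<close> by (intro mult_left_mono) auto
  moreover have "\<alpha> * (1 - p * (w / w0 - 1)) = - (1 + n * (w - 1))"
  proof -
    have 1: "\<alpha> * p * (w / w0) = n * w" using w0(1) unfolding w0(2)[symmetric] by simp
    have 2: "\<alpha> * p = n - 1 - \<alpha>" using assms by (simp add: p_def)
    have "\<alpha> * (1 - p * (w / w0 - 1)) = \<alpha> - \<alpha> * p * (w / w0) + \<alpha> * p"
      by (simp add: algebra_simps)
    then show ?thesis unfolding 1 unfolding 2 by (simp add: algebra_simps)
  qed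
  ultimately have "- (1 + n * (w - 1)) \<le> \<alpha> * (w0 powr p / w powr p)" by simp
  then have "- (1 + n * (w - 1)) * w powr p \<le> \<alpha> * (w0 powr p / w powr p) * w powr p"
    by (intro mult_right_mono) auto
  also have "\<dots> = \<alpha> * w0 powr p" using assms by simp
  finally show ?thesis by (simp add: w0_def algebra_simps)
qed

text \<open>The odd extension of \<open>carreau_F\<close>; the flux is \<open>Y\<close> times this function of \<open>U_Y\<close>. Working on the
  whole line avoids one-sided derivatives of the inverse at \<open>0\<close>.\<close>

definition carreau_stress :: "real \<Rightarrow> real \<Rightarrow> real \<Rightarrow> real \<Rightarrow> real \<Rightarrow> real" where
  "carreau_stress Cu \<alpha> c n p = carreau_factor Cu \<alpha> c n \<bar>p\<bar> * p"

text \<open>The derivative of \<open>carreau_stress\<close>, including at \<open>p = 0\<close>, where it is \<open>1\<close> because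
  \<open>0 powr \<alpha> = 0\<close>.\<close>

definition carreau_slope :: "real \<Rightarrow> real \<Rightarrow> real \<Rightarrow> real \<Rightarrow> real \<Rightarrow> real" where
  "carreau_slope Cu \<alpha> c n p =
     1 - c + c * ((1 + Cu powr \<alpha> * \<bar>p\<bar> powr \<alpha>) powr ((n - 1 - \<alpha>) / \<alpha>)
       * (1 + n * (Cu powr \<alpha> * \<bar>p\<bar> powr \<alpha>)))"

lemma carreau_slope_bounded_below:
  fixes Cu \<alpha> c n :: real
  assumes "\<alpha> > 0" "0 < c" "c < 1"
    and "n \<ge> 0 \<or>
         (n < 0 \<and> (1 - (\<alpha> + 1) / n) powr ((n - 1 - \<alpha>) / \<alpha>) < (1 - c) / (\<alpha> * c))"
  shows "\<exists>m>0. \<forall>p. m \<le> carreau_slope Cu \<alpha> c n p"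
proof (cases "n \<ge> 0")
  case True
  show ?thesis
  proof (intro exI conjI allI)
    show "1 - c \<le> carreau_slope Cu \<alpha> c n p" for p
      using True assms by (simp add: carreau_slope_def)
  qed (use assms in simp)
next
  case False
  define M where "M = (1 - (\<alpha> + 1) / n) powr ((n - 1 - \<alpha>) / \<alpha>)"
  have "M < (1 - c) / (\<alpha> * c)" using assms False by (auto simp: M_def)
  then have m: "0 < 1 - c + c * (- \<alpha> * M)" using assms by (simp add: field_simps)
  show ?thesis
  proof (intro exI conjI allI)
    fix p
    define w where "w = 1 + Cu powr \<alpha> * \<bar>p\<bar> powr \<alpha>"
    have "0 < w" unfolding w_def by (intro add_pos_nonneg) auto
    then have "- \<alpha> * M \<le> w powr ((n - 1 - \<alpha>) / \<alpha>) * (1 + n * (w - 1))"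
      unfolding M_def using assms False by (intro carreau_critical_bound) auto
    then have "c * (- \<alpha> * M) \<le> c * (w powr ((n - 1 - \<alpha>) / \<alpha>) * (1 + n * (w - 1)))"
      using assms by (intro mult_left_mono) auto
    then show "1 - c + c * (- \<alpha> * M) \<le> carreau_slope Cu \<alpha> c n p"
      by (simp add: carreau_slope_def w_def)
  qed (use m in simp)
qed

section \<open>The stress is continuously differentiable\<close>

lemma carreau_factor_pos: "0 < c \<Longrightarrow> c < 1 \<Longrightarrow> 0 < carreau_factor Cu \<alpha> c n \<zeta>"
  unfolding carreau_factor_def by (intro add_pos_nonneg) auto

lemma continuous_carreau_factor_abs:
  assumes "\<alpha> > 0"
  shows "continuous_on S (\<lambda>p. carreau_factor Cu \<alpha> c n \<bar>p\<bar>)"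
proof -
  have "1 + Cu powr \<alpha> * \<bar>p\<bar> powr \<alpha> \<noteq> 0" for p :: real
    by (smt (verit) mult_nonneg_nonneg powr_ge_zero)
  then show ?thesis
    unfolding carreau_factor_def using assms
    by (intro continuous_intros continuous_on_powr') auto
qed

lemma continuous_carreau_slope:
  assumes "\<alpha> > 0"
  shows "continuous_on S (carreau_slope Cu \<alpha> c n)"
proof -
  have "1 + Cu powr \<alpha> * \<bar>p\<bar> powr \<alpha> \<noteq> 0" for p :: real
    by (smt (verit) mult_nonneg_nonneg powr_ge_zero)
  then show ?thesis
    unfolding carreau_slope_def[abs_def] using assms
    by (intro continuous_intros continuous_on_powr') auto
qed

lemma carreau_stress_minus: "carreau_stress Cu \<alpha> c n (- p) = - carreau_stress Cu \<alpha> c n p"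
  by (simp add: carreau_stress_def)

lemma carreau_stress_deriv_pos:
  assumes "\<alpha> > 0" "p > 0"
  shows "(carreau_stress Cu \<alpha> c n has_real_derivative carreau_slope Cu \<alpha> c n p) (at p)"
proof -
  define k where "k = Cu powr \<alpha>"
  define z where "z = k * p powr \<alpha>"
  have k: "0 \<le> k" by (simp add: k_def)
  have w: "0 < 1 + z" unfolding z_def using k by (intro add_pos_nonneg) auto
  have "((\<lambda>p. 1 + k * p powr \<alpha>) has_real_derivative k * (\<alpha> * p powr (\<alpha> - 1))) (at p)"
    using DERIV_cmult[OF has_real_derivative_powr[OF assms(2)], of k \<alpha>]
    by (auto intro: derivative_eq_intros)
  from DERIV_chain2[OF has_real_derivative_powr this, of "(n - 1) / \<alpha>"] w
  have "((\<lambda>p. (1 + k * p powr \<alpha>) powr ((n - 1) / \<alpha>)) has_real_derivative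
          (n - 1) / \<alpha> * (1 + z) powr ((n - 1) / \<alpha> - 1) * (k * (\<alpha> * p powr (\<alpha> - 1)))) (at p)"
    by (simp add: z_def)
  from DERIV_mult[OF DERIV_add[OF DERIV_const DERIV_cmult[OF this]] DERIV_ident, of "1 - c" c]
  have "((\<lambda>p. carreau_factor Cu \<alpha> c n p * p) has_real_derivative
          c * ((n - 1) / \<alpha> * (1 + z) powr ((n - 1) / \<alpha> - 1) * (k * (\<alpha> * p powr (\<alpha> - 1)))) * p
          + (1 - c + c * (1 + z) powr ((n - 1) / \<alpha>))) (at p)"
    unfolding carreau_factor_def k_def[symmetric] by (simp add: z_def)
  also have "c * ((n - 1) / \<alpha> * (1 + z) powr ((n - 1) / \<alpha> - 1) * (k * (\<alpha> * p powr (\<alpha> - 1)))) * p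
          + (1 - c + c * (1 + z) powr ((n - 1) / \<alpha>)) = carreau_slope Cu \<alpha> c n p"
  proof -
    have 1: "(n - 1 - \<alpha>) / \<alpha> = (n - 1) / \<alpha> - 1" using assms by (simp add: field_simps)
    have 2: "(1 + z) powr ((n - 1) / \<alpha>) = (1 + z) powr ((n - 1) / \<alpha> - 1) * (1 + z)"
      using w by (simp add: powr_diff)
    have 3: "p powr (\<alpha> - 1) * p = p powr \<alpha>" using assms by (simp add: powr_diff)
    define P where "P = (1 + z) powr ((n - 1) / \<alpha> - 1)"
    have "c * ((n - 1) / \<alpha> * P * (k * (\<alpha> * p powr (\<alpha> - 1)))) * p
            = c * (n - 1) * P * (k * (p powr (\<alpha> - 1) * p))"
      using assms by simp
    also have "\<dots> = c * (n - 1) * P * z" by (simp add: 3 z_def)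
    finally have 4: "c * ((n - 1) / \<alpha> * P * (k * (\<alpha> * p powr (\<alpha> - 1)))) * p
            = c * (n - 1) * P * z" .
    have "carreau_slope Cu \<alpha> c n p = 1 - c + c * (P * (1 + n * z))"
      using assms by (simp add: carreau_slope_def 1 P_def k_def z_def)
    then show ?thesis
      unfolding 2 P_def[symmetric] 4 by (simp add: algebra_simps)
  qed
  finally have D: "((\<lambda>p. carreau_factor Cu \<alpha> c n p * p) has_real_derivative carreau_slope Cu \<alpha> c n p) (at p)" .
  show ?thesis
    by (rule has_field_derivative_transform_within_open[OF D, of "{0<..}"])
       (use assms in \<open>auto simp: carreau_stress_def\<close>)
qed

text \<open>The chain rule fails at \<open>p = 0\<close> when \<open>\<alpha> \<le> 1\<close>, since \<open>\<bar>p\<bar> powr \<alpha>\<close> is not differentiable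
  there. But the difference quotient at \<open>0\<close> is the factor itself, which is continuous. Negative
  arguments follow by oddness.\<close>

lemma carreau_stress_deriv:
  assumes "\<alpha> > 0"
  shows "(carreau_stress Cu \<alpha> c n has_real_derivative carreau_slope Cu \<alpha> c n p) (at p)"
proof (cases p "0::real" rule: linorder_cases)
  case greater
  with assms show ?thesis by (rule carreau_stress_deriv_pos)
next
  case equal
  have "isCont (\<lambda>p. carreau_factor Cu \<alpha> c n \<bar>p\<bar>) 0"
    using continuous_carreau_factor_abs[OF assms, of UNIV] by (simp add: continuous_on_eq_continuous_at)
  then have "(\<lambda>h. carreau_factor Cu \<alpha> c n \<bar>h\<bar>) \<midarrow>0\<rightarrow> carreau_slope Cu \<alpha> c n 0"
    using assms by (simp add: isCont_def carreau_factor_def carreau_slope_def)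
  then have "(\<lambda>h. (carreau_stress Cu \<alpha> c n (0 + h) - carreau_stress Cu \<alpha> c n 0) / h)
               \<midarrow>0\<rightarrow> carreau_slope Cu \<alpha> c n 0"
    by (rule Lim_transform_eventually) (auto simp: eventually_at_filter carreau_stress_def)
  then show ?thesis using equal by (simp add: DERIV_def)
next
  case less
  have "((\<lambda>q. - carreau_stress Cu \<alpha> c n (- q)) has_real_derivative
          - (carreau_slope Cu \<alpha> c n (- p) * - 1)) (at p)"
    by (intro DERIV_minus DERIV_chain2[OF carreau_stress_deriv_pos] derivative_eq_intros refl)
       (use assms less in auto)
  then show ?thesis by (simp add: carreau_stress_minus carreau_slope_def algebra_simps)
qed


section \<open>Functions whose derivative is bounded below by a positive constant\<close>

text \<open>By the mean value theorem \<open>f\<close> grows at least linearly with rate \<open>m\<close>. Hence it is strictly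
  increasing and unbounded in both directions, and its inverse is Lipschitz with constant
  \<open>1 / m\<close>; the inverse function rule needs only the continuity of the inverse.\<close>

lemma C1_diffeo_of_slope_bounded_below:
  fixes f f' :: "real \<Rightarrow> real"
  assumes deriv: "\<And>x. (f has_real_derivative f' x) (at x)"
    and cont: "continuous_on UNIV f'"
    and m: "0 < m" "\<And>x. m \<le> f' x"
  shows "bij f" "strict_mono f"
    and "\<And>y. (inv f has_real_derivative inverse (f' (inv f y))) (at y)"
    and "continuous_on UNIV (\<lambda>y. inverse (f' (inv f y)))"
proof -
  have growth: "m * (b - a) \<le> f b - f a" if less: "a < b" for a b
  proof -
    obtain z where "f b - f a = (b - a) * f' z"
      using MVT2[OF less, of f f'] deriv by blast
    then show ?thesis using m(2)[of z] less by (simp add: mult.commute)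
  qed
  show mono: "strict_mono f"
  proof
    fix a b :: real assume "a < b"
    with growth[OF this] m(1) show "f a < f b" by (smt (verit) mult_pos_pos)
  qed
  have contf: "continuous_on S f" for S
    using deriv by (meson DERIV_continuous continuous_at_imp_continuous_on)
  have "\<exists>x. y = f x" for y
  proof -
    \<comment> \<open>Over a length \<open>d\<close> the value of \<open>f\<close> changes by at least \<open>m * d > \<bar>y - f 0\<bar>\<close>.\<close>
    define d where "d = \<bar>y - f 0\<bar> / m + 1"
    have d: "0 < d" "\<bar>y - f 0\<bar> \<le> m * d"
      using m(1) by (auto simp: d_def field_simps add_pos_nonneg)
    have "f (- d) \<le> y" "y \<le> f d"
      using growth[of "- d" 0] growth[of 0 d] d by auto
    with IVT'[of f "- d" y d] d contf show ?thesis by force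
  qed
  then show bij: "bij f"
    using mono by (simp add: bij_def surj_def strict_mono_imp_inj_on)
  have right: "f (inv f y) = y" for y
    using bij by (simp add: bij_is_surj surj_f_inv_f)
  have lip: "\<bar>inv f y - inv f x\<bar> \<le> \<bar>y - x\<bar> / m" for x y
    using growth[of "inv f x" "inv f y"] growth[of "inv f y" "inv f x"] m(1)
    by (cases "inv f x" "inv f y" rule: linorder_cases) (auto simp: right field_simps)
  have "isCont (inv f) y" for y
  proof -
    have "((\<lambda>x. \<bar>x - y\<bar> / m) \<longlongrightarrow> \<bar>y - y\<bar> / m) (at y)"
      using m(1) by (intro tendsto_intros) auto
    then have lim: "((\<lambda>x. \<bar>x - y\<bar> / m) \<longlongrightarrow> 0) (at y)" by simp
    have "((\<lambda>x. inv f x - inv f y) \<longlongrightarrow> 0) (at y)"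
      by (rule Lim_null_comparison[OF _ lim]) (simp only: real_norm_def lip eventually_True)
    then show ?thesis unfolding isCont_def by (rule LIM_zero_cancel)
  qed
  note cont_inv = this
  show "(inv f has_real_derivative inverse (f' (inv f y))) (at y)" for y
  proof (rule DERIV_inverse_function[OF deriv])
    show "f' (inv f y) \<noteq> 0" using m(1) m(2)[of "inv f y"] by auto
    show "y - 1 < y" "y < y + 1" by auto
  qed (auto simp: right cont_inv)
  have "continuous_on UNIV (\<lambda>y. f' (inv f y))"
    using cont_inv
    by (intro continuous_on_compose2[OF cont] continuous_at_imp_continuous_on) auto
  then show "continuous_on UNIV (\<lambda>y. inverse (f' (inv f y)))"
    using m by (intro continuous_on_inverse) (auto, smt (verit))
qed

section \<open>Derivatives relative to an interval\<close>

text \<open>A connected set of reals with more than one point has no isolated points, so derivatives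
  relative to it are unique.\<close>

lemma deriv_on_eq:
  assumes "connected S" "\<And>y. S \<noteq> {y}" "x \<in> S"
    and "(f has_real_derivative D) (at x within S)"
  shows "deriv_on S f x = D"
  using assms connected_imp_perfect[of S x]
  by (intro vector_derivative_within)
     (auto simp: trivial_limit_within has_real_derivative_iff_has_vector_derivative)

lemma C_k_onI:
  fixes U U1 U2 :: "real \<Rightarrow> real"
  assumes S: "connected S" "\<And>y. S \<noteq> {y}"
    and U: "\<And>x. x \<in> S \<Longrightarrow> (U has_real_derivative U1 x) (at x within S)"
    and U1: "\<And>x. x \<in> S \<Longrightarrow> (U1 has_real_derivative U2 x) (at x within S)"
    and U2: "continuous_on S U2"
  shows "C_k_on 1 U S" "C_k_on 2 U S"
proof -
  have 1: "deriv_on S U x = U1 x" if "x \<in> S" for x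
    using deriv_on_eq[OF S that U[OF that]] .
  have D1: "(deriv_on S U has_real_derivative U2 x) (at x within S)" if "x \<in> S" for x
    using that 1
    by (intro has_field_derivative_transform_within[OF U1[OF that] zero_less_one that]) auto
  have 2: "deriv_on S (deriv_on S U) x = U2 x" if "x \<in> S" for x
    using deriv_on_eq[OF S that D1[OF that]] .
  have d: "U differentiable_on S" "deriv_on S U differentiable_on S"
    using U D1 unfolding differentiable_on_def by (meson real_differentiable_def)+
  moreover have "continuous_on S (deriv_on S U)"
    using d(2) by (rule differentiable_imp_continuous_on)
  moreover have "continuous_on S (deriv_on S (deriv_on S U))"
    using U2 by (rule continuous_on_eq) (simp add: 2)
  ultimately show "C_k_on 1 U S" "C_k_on 2 U S" by (simp_all add: numeral_2_eq_2)
qed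

lemma C_k_on_1D:
  assumes "C_k_on 1 U S"
  shows "\<And>x. x \<in> S \<Longrightarrow> (U has_real_derivative deriv_on S U x) (at x within S)"
    and "continuous_on S (deriv_on S U)"
  using assms
  by (auto simp: differentiable_on_def vector_derivative_works
        has_real_derivative_iff_has_vector_derivative)

section \<open>Reduction of the boundary value problem to an algebraic equation\<close>

text \<open>Both the flux and \<open>b * Y\<^sup>2 / 2\<close> have derivative \<open>b * Y\<close> inside the interval, are continuous up
  to its ends and vanish at \<open>Y = 0\<close>, so they are equal. Dividing by \<open>Y\<close> gives the claim except at
  \<open>Y = 0\<close>, where it is the boundary condition.\<close>

lemma classical_solution_first_integral:
  fixes R Cu b \<alpha> c n :: real
  assumes "R > 0" "\<alpha> > 0"
    and V: "classical_solution R Cu b \<alpha> c n V"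
    and Y: "Y \<in> {0..R}"
  shows "carreau_stress Cu \<alpha> c n (deriv_on {0..R} V Y) = b * Y / 2"
proof (cases "Y = 0")
  case True
  then show ?thesis using V by (simp add: classical_solution_def carreau_stress_def)
next
  case False
  let ?\<Phi> = "carreau_flux R Cu \<alpha> c n V"
  let ?E = "\<lambda>y. ?\<Phi> y - b * y\<^sup>2 / 2"
  have cont: "continuous_on {0..R} (deriv_on {0..R} V)"
    using V C_k_on_1D(2) by (auto simp: classical_solution_def)
  have "continuous_on {0..R} (\<lambda>y. carreau_factor Cu \<alpha> c n \<bar>deriv_on {0..R} V y\<bar>)"
    by (rule continuous_on_compose2[OF continuous_carreau_factor_abs[OF \<open>\<alpha> > 0\<close>, of UNIV] cont]) auto
  then have "continuous_on {0..R} ?E"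
    unfolding carreau_flux_def using cont by (intro continuous_intros) auto
  moreover have "(?E has_real_derivative 0) (at y)" if "0 < y" "y < R" for y
  proof -
    have "?\<Phi> field_differentiable at y" "1 / y * deriv ?\<Phi> y = b"
      using V that by (auto simp: classical_solution_def)
    then have "(?\<Phi> has_real_derivative b * y) (at y)"
      using that by (auto simp: field_simps dest!: field_differentiable_derivI)
    then show ?thesis by (auto intro!: derivative_eq_intros)
  qed
  ultimately have "?E Y = ?E 0"
    using assms by (intro DERIV_isconst2[of 0 R]) auto
  then have "Y * carreau_stress Cu \<alpha> c n (deriv_on {0..R} V Y) = Y * (b * Y / 2)"
    by (simp add: carreau_flux_def carreau_stress_def power2_eq_square algebra_simps)
  then show ?thesis using False by simp
qed

lemma eq_neg_integral_of_deriv: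
  fixes V h :: "real \<Rightarrow> real"
  assumes "\<And>x. x \<in> {0..R} \<Longrightarrow> (V has_real_derivative h x) (at x within {0..R})"
    and "V R = 0" "Y \<in> {0..R}"
  shows "V Y = - integral {Y..R} h"
proof -
  have "(h has_integral V R - V Y) {Y..R}"
  proof (rule fundamental_theorem_of_calculus)
    fix x assume "x \<in> {Y..R}"
    then show "(V has_vector_derivative h x) (at x within {Y..R})"
      using assms DERIV_subset[of V "h x" x "{0..R}" "{Y..R}"]
      by (auto simp: has_real_derivative_iff_has_vector_derivative[symmetric])
  qed (use assms in auto)
  then show ?thesis using assms(2) by (auto dest: integral_unique)
qed

section \<open>Existence, uniqueness and regularity\<close>

theorem theorem2p2:
  fixes R Cu b \<alpha> c n :: real
  assumes "R > 0" "Cu > 0" "b > 0" "\<alpha> > 0" "0 < c" "c < 1"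
    and "n \<ge> 0 \<or>
         (n < 0 \<and> (1 - (\<alpha> + 1) / n) powr ((n - 1 - \<alpha>) / \<alpha>) < (1 - c) / (\<alpha> * c))"
  shows "bij_betw (carreau_F Cu \<alpha> c n) {0..} {0..} \<and>
         (\<lambda>s. carreau_F_inv Cu \<alpha> c n (b * s / 2)) integrable_on {0..R} \<and>
         (\<exists>U. classical_solution R Cu b \<alpha> c n U \<and>
              (\<forall>V. classical_solution R Cu b \<alpha> c n V \<longrightarrow> (\<forall>Y\<in>{0..R}. V Y = U Y)) \<and>
              C_k_on 2 U {0..R} \<and>
              (\<forall>Y\<in>{0..R}.
                 U Y = - integral {Y..R} (\<lambda>s. carreau_F_inv Cu \<alpha> c n (b * s / 2)) \<and>
                 0 \<le> deriv_on {0..R} U Y \<and>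
                 deriv_on {0..R} U Y \<le> carreau_F_inv Cu \<alpha> c n (b * R / 2)))"
proof -
  let ?F = "carreau_F Cu \<alpha> c n" and ?Finv = "carreau_F_inv Cu \<alpha> c n"
  let ?T = "carreau_stress Cu \<alpha> c n" and ?T' = "carreau_slope Cu \<alpha> c n"
  define G where "G = inv ?T"
  obtain m where m: "0 < m" "\<And>p. m \<le> ?T' p"
    using carreau_slope_bounded_below[OF assms(4-7)] by blast
  note diffeo = C1_diffeo_of_slope_bounded_below
    [OF carreau_stress_deriv[OF \<open>\<alpha> > 0\<close>] continuous_carreau_slope[OF \<open>\<alpha> > 0\<close>] m, folded G_def]
  have TG: "?T (G y) = y" and GT: "G (?T p) = p" for y p
    using diffeo(1) by (simp_all add: G_def bij_is_surj surj_f_inv_f bij_is_inj inv_f_f)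
  have T_pos: "0 \<le> ?T p \<longleftrightarrow> 0 \<le> p" for p
    using carreau_factor_pos[OF assms(5,6), of Cu \<alpha> n "\<bar>p\<bar>"]
    by (simp add: carreau_stress_def zero_le_mult_iff)
  have G_pos: "0 \<le> G y \<longleftrightarrow> 0 \<le> y" for y
    using T_pos[of "G y"] by (simp add: TG)
  have G_mono: "G x \<le> G y" if "x \<le> y" for x y
    using strict_mono_less_eq[OF diffeo(2), of "G x" "G y"] that by (simp add: TG)
  have FT: "?F p = ?T p" if "0 \<le> p" for p
    using that by (simp add: carreau_F_def carreau_stress_def)
  have bij: "bij_betw ?F {0..} {0..}"
    by (rule bij_betw_byWitness[where f' = G]) (auto simp: FT TG GT T_pos G_pos)
  have Finv: "?Finv y = G y" if "0 \<le> y" for y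
    unfolding carreau_F_inv_def
    using bij that by (intro inv_into_f_eq) (auto simp: FT TG G_pos bij_betw_def)

  \<comment> \<open>\<open>h\<close> is the derivative that every classical solution must have, and \<open>h'\<close> its derivative.\<close>
  define h where "h = (\<lambda>s. G (b * s / 2))"
  define h' where "h' = (\<lambda>s. inverse (?T' (G (b * s / 2))) * (b / 2))"
  have h: "?Finv (b * s / 2) = h s" if "0 \<le> s" for s
    using that assms by (simp add: h_def Finv)
  have h_deriv: "(h has_real_derivative h' s) (at s)" for s
    unfolding h_def h'_def
    by (rule DERIV_chain2[OF diffeo(3)]) (auto intro!: derivative_eq_intros)
  have h'_cont: "continuous_on S h'" for S
    unfolding h'_def
    by (intro continuous_on_mult continuous_on_const
        continuous_on_compose2[OF diffeo(4), of S "\<lambda>s. b * s / 2"] continuous_intros) auto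
  have h_cont: "continuous_on S h" for S
    using h_deriv by (meson DERIV_continuous continuous_at_imp_continuous_on)
  have h0: "h 0 = 0" using GT[of 0] by (simp add: h_def carreau_stress_def)

  define U where "U = (\<lambda>Y. - integral {Y..R} h)"
  have U_deriv: "(U has_real_derivative h Y) (at Y within {0..R})" if "Y \<in> {0..R}" for Y
    using DERIV_minus[OF integral_has_real_derivative'[OF h_cont that]] by (simp add: U_def)
  have nontrivial: "{0..R} \<noteq> {y}" "{0<..<R} \<noteq> {y}" for y
  proof -
    have "{R / 3, R / 2} \<subseteq> {0..R}" "{R / 3, R / 2} \<subseteq> {0<..<R}" using \<open>R > 0\<close> by auto
    then show "{0..R} \<noteq> {y}" "{0<..<R} \<noteq> {y}" using \<open>R > 0\<close> by fastforce+
  qed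
  have U': "deriv_on {0..R} U Y = h Y" if "Y \<in> {0..R}" for Y
    using that U_deriv nontrivial by (intro deriv_on_eq) auto
  have U_deriv': "(U has_real_derivative h Y) (at Y within {0<..<R})" if "Y \<in> {0<..<R}" for Y
    by (rule DERIV_subset[OF U_deriv]) (use that in auto)
  note h_deriv' = has_field_derivative_at_within[OF h_deriv]
  note C2 = C_k_onI[OF connected_Icc nontrivial(1) U_deriv h_deriv' h'_cont]
  note C2' = C_k_onI(2)[OF connected_Ioo nontrivial(2) U_deriv' h_deriv' h'_cont]
  \<comment> \<open>Substituting \<open>U' = h\<close> inverts the first integral, so the flux is an explicit parabola.\<close>
  have flux: "carreau_flux R Cu \<alpha> c n U Y = b / 2 * Y\<^sup>2" if "Y \<in> {0..R}" for Y
  proof -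
    have "carreau_flux R Cu \<alpha> c n U Y = Y * ?T (h Y)"
      using that by (simp add: carreau_flux_def carreau_stress_def U')
    then show ?thesis by (simp add: h_def TG power2_eq_square)
  qed
  have flux_deriv: "(carreau_flux R Cu \<alpha> c n U has_real_derivative b * Y) (at Y)"
    if "Y \<in> {0<..<R}" for Y
    by (rule has_field_derivative_transform_within_open[of "\<lambda>Y. b / 2 * Y\<^sup>2" _ _ "{0<..<R}"])
       (use that in \<open>auto simp: flux intro!: derivative_eq_intros\<close>)
  have "1 / Y * deriv (carreau_flux R Cu \<alpha> c n U) Y = b" if "Y \<in> {0<..<R}" for Y
    using that DERIV_imp_deriv[OF flux_deriv[OF that]] by simp
  moreover have "carreau_flux R Cu \<alpha> c n U field_differentiable at Y" if "Y \<in> {0<..<R}" for Y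
    using flux_deriv[OF that] unfolding field_differentiable_def by blast
  moreover have "U R = 0" by (simp add: U_def)
  moreover have "deriv_on {0..R} U 0 = 0" using U'[of 0] h0 \<open>R > 0\<close> by simp
  ultimately have sol: "classical_solution R Cu b \<alpha> c n U"
    unfolding classical_solution_def using C2(1) C2' by blast
  have unique: "V Y = U Y" if V: "classical_solution R Cu b \<alpha> c n V" and Y: "Y \<in> {0..R}" for V Y
    unfolding U_def
  proof (rule eq_neg_integral_of_deriv[OF _ _ Y])
    show "V R = 0" using V by (simp add: classical_solution_def)
    fix x assume x: "x \<in> {0..R}"
    have "deriv_on {0..R} V x = h x"
      using classical_solution_first_integral[OF \<open>R > 0\<close> \<open>\<alpha> > 0\<close> V x]
      by (metis GT h_def)
    then show "(V has_real_derivative h x) (at x within {0..R})"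
      using V C_k_on_1D(1)[OF _ x] by (metis classical_solution_def)
  qed
  have "U Y = - integral {Y..R} (\<lambda>s. ?Finv (b * s / 2)) \<and>
        0 \<le> deriv_on {0..R} U Y \<and> deriv_on {0..R} U Y \<le> ?Finv (b * R / 2)"
    if "Y \<in> {0..R}" for Y
  proof (intro conjI)
    show "U Y = - integral {Y..R} (\<lambda>s. ?Finv (b * s / 2))"
      unfolding U_def using that h by (auto intro!: integral_cong)
    show "0 \<le> deriv_on {0..R} U Y" using that U' assms by (simp add: h_def G_pos)
    show "deriv_on {0..R} U Y \<le> ?Finv (b * R / 2)"
      using that U' assms h[of R] by (simp add: h_def G_mono)
  qed
  moreover have "(\<lambda>s. ?Finv (b * s / 2)) integrable_on {0..R}"
    using integrable_continuous_real[OF h_cont] h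
    by (subst integrable_cong[where g = h]) auto
  ultimately show ?thesis using bij sol unique C2 by blast
qed

end
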